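(* Let $m,r$ be positive integers. The AWG-based network $\mathcal{W}(m,rm)$ is equivalent to the generalized shuffle network $\mathcal{N}(m,rm)$ in terms of the connectivity between input channels and output channels. That is, for $0\le p\le m-1$, $0\le a\le r-1$, $0\le q'\le m-1$, label the input channel $(\underline{p}\,\underline{a},\lambda_{[p+q']_m})$ of $\mathcal{W}(m,rm)$ by the field address $\underline{p}\,\underline{a}\,\underline{q}'$ and the output channel $(\underline{a}\,\underline{q}',\lambda_{[q'+p]_m})$ by the field address $\underline{a}\,\underline{q}'\,\underline{p}$, and put $q=am+q'$. Then each input group $p$ is connected to each output group $\underline{a}\,\underline{q}'$ via exactly one connection, namely $\tilde C(p,\underline{a}\,\underline{q}',\lambda_{[p+q']_m})$, which joins input channel $\underline{p}\,\underline{a}\,\underline{q}'$ to output channel $\underline{a}\,\underline{q}'\,\underline{p}$. Moreover, $\tilde C(p,\underline{a}\,\underline{q}',\lambda_{[p+q']_m})\leftrightarrow C(\underline{p}\,\underline{q},\underline{q}\,\underline{p})$ is a one-to-one and onto correspondence between the connections of $\mathcal{W}(m,rm)$ and the connections of $\mathcal{N}(m,rm)$.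
   Context: Notation: $[X]_m$ denotes $X \bmod m$, taken in $\{0,\dots,m-1\}$. Generalized shuffle network $\mathcal{N}(m,l)$: it has $N=ml$ inputs divided into $m$ input groups of $l$ ports each, and $N$ outputs divided into $l$ output groups of $m$ ports each. For $p=0,\dots,m-1$ and $q=0,\dots,l-1$, the $q$th port of input group $p$ (address $\underline{p}\,\underline{q}$) is connected to the $p$th port of output group $q$ (address $\underline{q}\,\underline{p}$). This connection is denoted $C(\underline{p}\,\underline{q},\underline{q}\,\underline{p})$, and there are no other connections. A network is functionally equivalent to $\mathcal{N}(m,l)$ if each input group connects with each output group via exactly one connection, and each input connects to the output whose address is obtained by exchanging the two sub-addresses (group, position in group) of the input address. An $m\times m$ AWG (arrayed waveguide grating) is a passive wavelength router with inputs $0,\dots,m-1$, outputs $0,\dots,m-1$ and wavelength set $\{\lambda_0,\dots,\lambda_{m-1}\}$. Input $p$ is connected to output $q'$ via wavelength $\lambda_i$ if and only if $i=[p+q']_m$ (the signal keeps its wavelength). The network $\mathcal{W}(m,rm)$ is built from $r$ AWGs of size $m\times m$, numbered $a=0,\dots,r-1$, all using the same wavelength set. It has $m$ input groups $p=0,\dots,m-1$, each containing $r$ input ports. The $a$th port of input group $p$, labelled $\underline{p}\,\underline{a}$, is linked to the $p$th input of AWG $a$. It has $rm$ output groups, each consisting of one output port. Output group $q\in\{0,\dots,rm-1\}$ is labelled $\underline{a}\,\underline{q}'$ with $a=\lfloor q/m\rfloor$ and $q'=[q]_m$, and is linked to output $q'$ of AWG $a$. Input (resp. output) channels are pairs (input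 port, wavelength) (resp. (output port, wavelength)). The connection $\tilde C(p,\underline{a}\,\underline{q}',\lambda_{[p+q']_m})$ goes from input port $\underline{p}\,\underline{a}$ through AWG $a$ (from its input $p$ to its output $q'$) to output port $\underline{a}\,\underline{q}'$, using wavelength $\lambda_{[p+q']_m}$. *)

theory Defs
  imports Main
begin

text \<open>
  The members of \<open>inputs\<close> and \<open>outputs\<close> are the end points of connections: the ports of
  \<open>shuffle_network\<close>, the channels (port, wavelength) of \<open>awg_network\<close>.  Connections are elements
  in their own right, so that distinct connections may have the same end points.
\<close>

record ('i, 'o, 'c) network =
  inputs :: "'i set"
  outputs :: "'o set"
  in_group :: "'i \<Rightarrow> nat"
  out_group :: "'o \<Rightarrow> nat"
  connections :: "'c set"
  source :: "'c \<Rightarrow> 'i"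
  target :: "'c \<Rightarrow> 'o"

text \<open>An address is a pair (group, position in the group).\<close>

type_synonym address = "nat \<times> nat"

definition shuffle_connection :: "nat \<Rightarrow> nat \<Rightarrow> address \<times> address" where
  "shuffle_connection p q = ((p, q), (q, p))"

definition shuffle_network :: "nat \<Rightarrow> nat \<Rightarrow> (address, address, address \<times> address) network" where
  "shuffle_network m l =
    \<lparr> inputs = {..<m} \<times> {..<l},
      outputs = {..<l} \<times> {..<m},
      in_group = fst,
      out_group = fst,
      connections = {shuffle_connection p q | p q. p < m \<and> q < l},
      source = fst,
      target = snd \<rparr>"

text \<open>
  The functions \<open>ilab\<close> and \<open>olab\<close> send an address to the input or output that carries it; the
  group part of the address has to be the group to which that input or output belongs.
\<close>

definition functionally_equivalent_to_shuffle ::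
  "nat \<Rightarrow> nat \<Rightarrow> ('i, 'o, 'c) network \<Rightarrow> (address \<Rightarrow> 'i) \<Rightarrow> (address \<Rightarrow> 'o) \<Rightarrow> bool" where
  "functionally_equivalent_to_shuffle m l N ilab olab \<longleftrightarrow>
    bij_betw ilab ({..<m} \<times> {..<l}) (inputs N) \<and>
    bij_betw olab ({..<l} \<times> {..<m}) (outputs N) \<and>
    (\<forall>p<m. \<forall>q<l. in_group N (ilab (p, q)) = p \<and> out_group N (olab (q, p)) = q) \<and>
    (\<forall>c\<in>connections N. source N c \<in> inputs N \<and> target N c \<in> outputs N) \<and>
    (\<forall>p<m. \<forall>q<l. \<exists>!c. c \<in> connections N \<and>
       in_group N (source N c) = p \<and> out_group N (target N c) = q) \<and>
    (\<forall>x\<in>{..<m} \<times> {..<l}. \<forall>y\<in>{..<l} \<times> {..<m}.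
       (\<exists>c\<in>connections N. source N c = ilab x \<and> target N c = olab y) \<longleftrightarrow> y = prod.swap x)"

text \<open>
  Wavelengths are represented by their indices.  An input port is the pair \<open>(p, a)\<close> of its group
  and its position in the group.  An output group has a single port, represented by the number
  \<open>q\<close> of the group.
\<close>

type_synonym wavelength = nat
type_synonym in_port = "nat \<times> nat"
type_synonym out_port = nat
type_synonym in_channel = "in_port \<times> wavelength"
type_synonym out_channel = "out_port \<times> wavelength"

definition awg_route :: "nat \<Rightarrow> nat \<Rightarrow> nat \<Rightarrow> wavelength \<Rightarrow> bool" where
  "awg_route m x y i \<longleftrightarrow> x < m \<and> y < m \<and> i < m \<and> i = (x + y) mod m"

definition out_port_label :: "nat \<Rightarrow> out_port \<Rightarrow> nat \<times> nat" where
  "out_port_label m q = (q div m, q mod m)"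

text \<open>\<open>in_link m r s b x\<close>: the input port \<open>s\<close> is linked to input \<open>x\<close> of AWG \<open>b\<close>;
  \<open>out_link m r b y q\<close>: output \<open>y\<close> of AWG \<open>b\<close> is linked to the output port \<open>q\<close>.\<close>

definition in_link :: "nat \<Rightarrow> nat \<Rightarrow> in_port \<Rightarrow> nat \<Rightarrow> nat \<Rightarrow> bool" where
  "in_link m r s b x \<longleftrightarrow> s \<in> {..<m} \<times> {..<r} \<and> x = fst s \<and> b = snd s"

definition out_link :: "nat \<Rightarrow> nat \<Rightarrow> nat \<Rightarrow> nat \<Rightarrow> out_port \<Rightarrow> bool" where
  "out_link m r b y q \<longleftrightarrow> q < r * m \<and> (b, y) = out_port_label m q"

text \<open>
  \<open>Path s b x y q i\<close> is the path from input port \<open>s\<close> through AWG \<open>b\<close>, from its input \<open>x\<close> to its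
  output \<open>y\<close>, to output port \<open>q\<close>, on wavelength \<open>i\<close>.
\<close>

datatype path =
  Path (path_in: in_port) (path_awg: nat) (awg_in: nat) (awg_out: nat) (path_out: out_port)
    (path_wavelength: wavelength)

definition awg_network :: "nat \<Rightarrow> nat \<Rightarrow> (in_channel, out_channel, path) network" where
  "awg_network m r =
    \<lparr> inputs = ({..<m} \<times> {..<r}) \<times> {..<m},
      outputs = {..<r * m} \<times> {..<m},
      in_group = (\<lambda>((p, a), i). p),
      out_group = (\<lambda>(q, i). q),
      connections =
        {Path s b x y q i | s b x y q i. in_link m r s b x \<and> awg_route m x y i \<and> out_link m r b y q},
      source = (\<lambda>c. (path_in c, path_wavelength c)),
      target = (\<lambda>c. (path_out c, path_wavelength c)) \<rparr>"

definition awg_connection :: "nat \<Rightarrow> nat \<Rightarrow> nat \<times> nat \<Rightarrow> wavelength \<Rightarrow> path" where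
  "awg_connection m p = (\<lambda>(a, q') i. Path (p, a) a p q' (a * m + q') i)"

text \<open>The channels with field addresses \<open>p a q'\<close> and \<open>a q' p\<close>.\<close>

definition in_channel_at :: "nat \<Rightarrow> nat \<times> nat \<times> nat \<Rightarrow> in_channel" where
  "in_channel_at m = (\<lambda>(p, a, q'). ((p, a), (p + q') mod m))"

definition out_channel_at :: "nat \<Rightarrow> nat \<times> nat \<times> nat \<Rightarrow> out_channel" where
  "out_channel_at m = (\<lambda>(a, q', p). (a * m + q', (q' + p) mod m))"

text \<open>The same labels read as shuffle addresses, the pair \<open>a q'\<close> being written as \<open>q = a m + q'\<close>.\<close>

definition in_label :: "nat \<Rightarrow> address \<Rightarrow> in_channel" where
  "in_label m = (\<lambda>(p, q). in_channel_at m (p, q div m, q mod m))"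

definition out_label :: "nat \<Rightarrow> address \<Rightarrow> out_channel" where
  "out_label m = (\<lambda>(q, p). out_channel_at m (q div m, q mod m, p))"

end

theory Submission
  imports Defs
begin

text \<open>
  Modulo \<open>m\<close>, the number \<open>q = a m + q'\<close> agrees with \<open>q'\<close>, so the pair \<open>(p, q)\<close> determines the AWG,
  its ports and the wavelength \<open>(p + q) mod m\<close>.  Conversely, a channel determines its field address
  because addition of a fixed residue is injective modulo \<open>m\<close>.
\<close>

lemma combine_less_mult: "a * m + y < r * m" if "a < r" "y < m" for a m r y :: nat
proof -
  have "a * m + y < Suc a * m" using that(2) by simp
  also have "\<dots> \<le> r * m" using that(1) by (intro mult_le_mono1) simp
  finally show ?thesis .
qed

text \<open>Division with remainder: this turns the field pair \<open>a q'\<close> into the single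
  group number \<open>q\<close> and back, and so passes from three-part field addresses to two-part
  shuffle addresses.\<close>

lemma bij_betw_div_mod:
  "bij_betw (\<lambda>q. (q div m, q mod m)) {..<r * m} ({..<r} \<times> {..<m})" if "m > 0" for m r :: nat
  by (rule bij_betw_byWitness[where f' = "\<lambda>(a, y). a * m + y"])
    (use that in \<open>auto simp: combine_less_mult less_mult_imp_div_less\<close>)

lemma add_mod_cancel_left:
  "y = z" if "(p + y) mod m = (p + z) mod m" "y < m" "z < m" for m p y z :: nat
proof -
  \<comment> \<open>Subtraction on the naturals truncates, so \<open>p\<close> is cancelled over the
    integers.\<close>
  have "(int p + int y) mod int m = (int p + int z) mod int m"
    using that(1) by (simp flip: of_nat_add of_nat_mod)
  then have "(int p + int y - int p) mod int m = (int p + int z - int p) mod int m"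
    by (rule mod_diff_cong[OF _ refl])
  then have "int y mod int m = int z mod int m" by simp
  then show ?thesis using that(2,3) by (simp flip: of_nat_mod)
qed

text \<open>The port shows \<open>p\<close> and \<open>a\<close>; once \<open>p\<close> is known,
  the wavelength determines \<open>q'\<close>. Surjectivity comes from counting: domain and codomain
  both have \<open>m * r * m\<close> elements, so it suffices that the image lies in the
  codomain.\<close>

lemma bij_betw_in_channel_at:
  "bij_betw (in_channel_at m) ({..<m} \<times> {..<r} \<times> {..<m}) (inputs (awg_network m r))"
proof (rule bij_betw_imageI)
  let ?A = "{..<m} \<times> {..<r} \<times> {..<m}"
  show inj: "inj_on (in_channel_at m) ?A"
    by (auto simp: inj_on_def in_channel_at_def dest: add_mod_cancel_left)
  show "in_channel_at m ` ?A = inputs (awg_network m r)"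
  proof (rule card_subset_eq)
    show "in_channel_at m ` ?A \<subseteq> inputs (awg_network m r)"
      by (auto simp: in_channel_at_def awg_network_def)
  qed (auto simp: card_image[OF inj] awg_network_def card_cartesian_product)
qed

lemma bij_betw_out_channel_at:
  "bij_betw (out_channel_at m) ({..<r} \<times> {..<m} \<times> {..<m}) (outputs (awg_network m r))"
proof (rule bij_betw_imageI)
  let ?A = "{..<r} \<times> {..<m} \<times> {..<m}"
  show inj: "inj_on (out_channel_at m) ?A"
  proof (rule inj_onI, clarsimp simp: out_channel_at_def)
    fix a y p a' y' p'
    assume lt: "y < m" "p < m" "y' < m" "p' < m"
      and port: "a * m + y = a' * m + y'" and wl: "(y + p) mod m = (y' + p') mod m"
    \<comment> \<open>The port number alone yields \<open>y\<close> as remainder and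
      \<open>a\<close> as quotient; the wavelength is then left to determine
      \<open>p\<close>.\<close>
    have "(a * m + y) mod m = (a' * m + y') mod m" "(a * m + y) div m = (a' * m + y') div m"
      using port by simp_all
    then have "y = y'" "a = a'" using lt by simp_all
    then show "a = a' \<and> y = y' \<and> p = p'"
      using wl lt by (auto dest: add_mod_cancel_left)
  qed
  show "out_channel_at m ` ?A = outputs (awg_network m r)"
  proof (rule card_subset_eq)
    show "out_channel_at m ` ?A \<subseteq> outputs (awg_network m r)"
      by (auto simp: out_channel_at_def awg_network_def combine_less_mult)
  qed (auto simp: card_image[OF inj] awg_network_def card_cartesian_product)
qed

text \<open>The label is the field address map applied after \<open>q\<close> is split into quotient
  and remainder, so it is a composition of bijections.\<close>

lemma bij_betw_in_label:
  assumes "m > 0"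
  shows "bij_betw (in_label m) ({..<m} \<times> {..<r * m}) (inputs (awg_network m r))"
proof -
  have "in_label m = in_channel_at m \<circ> map_prod id (\<lambda>q. (q div m, q mod m))"
    by (auto simp: in_label_def fun_eq_iff)
  moreover have "bij_betw (map_prod id (\<lambda>q. (q div m, q mod m)))
      ({..<m} \<times> {..<r * m}) ({..<m} \<times> {..<r} \<times> {..<m})"
    by (intro bij_betw_map_prod bij_betw_div_mod bij_betw_id assms)
  ultimately show ?thesis
    using bij_betw_trans[OF _ bij_betw_in_channel_at] by simp
qed

lemma bij_betw_out_label:
  assumes "m > 0"
  shows "bij_betw (out_label m) ({..<r * m} \<times> {..<m}) (outputs (awg_network m r))"
proof -
  \<comment> \<open>Splitting the first component nests the pair on the left, whereas field
    addresses are nested on the right; \<open>?f\<close> reassociates.\<close>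
  let ?f = "\<lambda>((a, y), p). (a, y, p)"
  have "out_label m = out_channel_at m \<circ> (?f \<circ> map_prod (\<lambda>q. (q div m, q mod m)) id)"
    by (auto simp: out_label_def fun_eq_iff)
  moreover have "bij_betw (map_prod (\<lambda>q. (q div m, q mod m)) id)
      ({..<r * m} \<times> {..<m}) (({..<r} \<times> {..<m}) \<times> {..<m})"
    by (intro bij_betw_map_prod bij_betw_div_mod bij_betw_id assms)
  moreover have "bij_betw ?f (({..<r} \<times> {..<m}) \<times> {..<m}) ({..<r} \<times> {..<m} \<times> {..<m})"
    by (rule bij_betw_byWitness[where f' = "\<lambda>(a, y, p). ((a, y), p)"]) auto
  ultimately show ?thesis
    using bij_betw_trans[OF bij_betw_trans bij_betw_out_channel_at] by simp
qed

text \<open>A normal form indexed by input group and output group. The wavelength may use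
  \<open>q\<close> itself because \<open>q\<close> and \<open>q mod m\<close> are congruent modulo
  \<open>m\<close>.\<close>

definition awg_path :: "nat \<Rightarrow> nat \<Rightarrow> nat \<Rightarrow> path" where
  "awg_path m p q = Path (p, q div m) (q div m) p (q mod m) q ((p + q) mod m)"

lemma awg_connection_eq_awg_path:
  "y < m \<Longrightarrow> awg_connection m p (a, y) ((p + y) mod m) = awg_path m p (a * m + y)"
  using mod_mult_self3[of a m "p + y"]
  by (simp add: awg_connection_def awg_path_def ac_simps)

text \<open>The output port \<open>q\<close> fixes both the AWG and its output, the input group
  fixes the AWG's input, and these two ends fix the wavelength. The input port must sit on the same
  AWG, so only \<open>p\<close> and \<open>q\<close> remain free.\<close>

lemma connections_awg_network:
  "connections (awg_network m r) = {awg_path m p q | p q. p < m \<and> q < r * m}"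
proof -
  have route: "in_link m r s b x \<and> awg_route m x y i \<and> out_link m r b y q \<longleftrightarrow>
      x < m \<and> q < r * m \<and> Path s b x y q i = awg_path m x q" for s b x y q i
    \<comment> \<open>For \<open>m = 0\<close> both sides are false; otherwise
      \<open>q mod m < m\<close>, and \<open>q < r * m\<close> gives an AWG number below
      \<open>r\<close>.\<close>
    by (cases s; cases "m = 0")
      (auto simp: awg_path_def in_link_def out_link_def awg_route_def
        out_port_label_def mod_add_right_eq less_mult_imp_div_less)
  show ?thesis
    unfolding awg_network_def by (simp add: route) (auto simp: awg_path_def)
qed

lemma source_awg_path: "source (awg_network m r) (awg_path m p q) = in_label m (p, q)"
  by (simp add: awg_network_def awg_path_def in_label_def in_channel_at_def mod_simps)

text \<open>Together with \<open>source_awg_path\<close> this is the exchange of sub-addresses: the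
  wavelength sum is symmetric, so it encodes \<open>q mod m\<close> at the input and
  \<open>p\<close> at the output.\<close>

lemma target_awg_path: "target (awg_network m r) (awg_path m p q) = out_label m (q, p)"
  by (simp add: awg_network_def awg_path_def out_label_def out_channel_at_def mod_simps add.commute)

lemma in_group_in_label: "in_group (awg_network m r) (in_label m (p, q)) = p"
  by (simp add: awg_network_def in_label_def in_channel_at_def)

lemma out_group_out_label: "out_group (awg_network m r) (out_label m (q, p)) = q"
  by (simp add: awg_network_def out_label_def out_channel_at_def)

text \<open>The groups of the two ends of \<open>awg_path m p q\<close> give back \<open>p\<close>
  and \<open>q\<close>. The singleton form provides uniqueness and also names the
  connection.\<close>

lemma connections_between_groups:
  assumes "p < m" "q < r * m"
  shows "{c \<in> connections (awg_network m r).
      in_group (awg_network m r) (source (awg_network m r) c) = p \<and>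
      out_group (awg_network m r) (target (awg_network m r) c) = q} = {awg_path m p q}"
  using assms
  by (auto simp: connections_awg_network source_awg_path target_awg_path
      in_group_in_label out_group_out_label)

lemma functionally_equivalent_awg_network:
  assumes "m > 0"
  shows "functionally_equivalent_to_shuffle m (r * m) (awg_network m r) (in_label m) (out_label m)"
  unfolding functionally_equivalent_to_shuffle_def
proof (intro conjI ballI allI impI)
  let ?N = "awg_network m r"
  show "bij_betw (in_label m) ({..<m} \<times> {..<r * m}) (inputs ?N)"
    by (rule bij_betw_in_label[OF assms])
  show "bij_betw (out_label m) ({..<r * m} \<times> {..<m}) (outputs ?N)"
    by (rule bij_betw_out_label[OF assms])
  fix p q assume pq: "p < m" "q < r * m"
  show "in_group ?N (in_label m (p, q)) = p" "out_group ?N (out_label m (q, p)) = q"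
    by (rule in_group_in_label out_group_out_label)+
  show "\<exists>!c. c \<in> connections ?N \<and>
      in_group ?N (source ?N c) = p \<and> out_group ?N (target ?N c) = q"
    using connections_between_groups[OF pq] by (auto simp: set_eq_iff)
next
  let ?N = "awg_network m r"
  fix c assume "c \<in> connections ?N"
  then obtain p q where c: "c = awg_path m p q" "p < m" "q < r * m"
    by (auto simp: connections_awg_network)
  show "source ?N c \<in> inputs ?N"
    using c by (auto simp: source_awg_path intro!: bij_betw_apply[OF bij_betw_in_label[OF assms]])
  show "target ?N c \<in> outputs ?N"
    using c by (auto simp: target_awg_path intro!: bij_betw_apply[OF bij_betw_out_label[OF assms]])
next
  let ?N = "awg_network m r"
  fix x y
  assume x: "x \<in> {..<m} \<times> {..<r * m}" and y: "y \<in> {..<r * m} \<times> {..<m}"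
  \<comment> \<open>Injectivity of the labels turns equal end channels into equal addresses,
    reducing the claim to the swapped labels of \<open>awg_path\<close>.\<close>
  have inj_in: "inj_on (in_label m) ({..<m} \<times> {..<r * m})"
    using bij_betw_in_label[OF assms] by (rule bij_betw_imp_inj_on)
  have inj_out: "inj_on (out_label m) ({..<r * m} \<times> {..<m})"
    using bij_betw_out_label[OF assms] by (rule bij_betw_imp_inj_on)
  show "(\<exists>c\<in>connections ?N. source ?N c = in_label m x \<and> target ?N c = out_label m y)
      \<longleftrightarrow> y = prod.swap x"
  proof
    assume "\<exists>c\<in>connections ?N. source ?N c = in_label m x \<and> target ?N c = out_label m y"
    then obtain p q where pq: "p < m" "q < r * m"
      and "in_label m (p, q) = in_label m x" "out_label m (q, p) = out_label m y"
      by (auto simp: connections_awg_network source_awg_path target_awg_path)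
    then have "(p, q) = x" "(q, p) = y"
      using x y by (auto dest: inj_onD[OF inj_in] inj_onD[OF inj_out])
    then show "y = prod.swap x" by auto
  next
    assume "y = prod.swap x"
    then show "\<exists>c\<in>connections ?N. source ?N c = in_label m x \<and> target ?N c = out_label m y"
      using x by (intro bexI[of _ "awg_path m (fst x) (snd x)"])
        (force simp: connections_awg_network source_awg_path target_awg_path)+
  qed
qed

text \<open>A path is determined by its input group and output port. The inverse reads
  \<open>p\<close> and \<open>q\<close> off the source address of the shuffle connection and
  rebuilds the path.\<close>

lemma bij_betw_awg_shuffle_connections:
  "bij_betw (\<lambda>c. shuffle_connection (fst (path_in c)) (path_out c))
    (connections (awg_network m r)) (connections (shuffle_network m (r * m)))"
  by (rule bij_betw_byWitness[where f' = "\<lambda>c. awg_path m (fst (fst c)) (snd (fst c))"])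
    (auto simp: connections_awg_network shuffle_network_def shuffle_connection_def awg_path_def)

theorem mainTheorem3:
  fixes m r :: nat
  assumes "m > 0" and "r > 0"
  shows "functionally_equivalent_to_shuffle m (r * m) (awg_network m r) (in_label m) (out_label m) \<and>
    bij_betw (in_channel_at m) ({..<m} \<times> {..<r} \<times> {..<m}) (inputs (awg_network m r)) \<and>
    bij_betw (out_channel_at m) ({..<r} \<times> {..<m} \<times> {..<m}) (outputs (awg_network m r)) \<and>
    (\<forall>p<m. \<forall>a<r. \<forall>q'<m.
      out_port_label m (a * m + q') = (a, q') \<and>
      {c \<in> connections (awg_network m r).
         in_group (awg_network m r) (source (awg_network m r) c) = p \<and>
         out_group (awg_network m r) (target (awg_network m r) c) = a * m + q'}
        = {awg_connection m p (a, q') ((p + q') mod m)} \<and>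
      source (awg_network m r) (awg_connection m p (a, q') ((p + q') mod m))
        = in_channel_at m (p, a, q') \<and>
      target (awg_network m r) (awg_connection m p (a, q') ((p + q') mod m))
        = out_channel_at m (a, q', p)) \<and>
    (\<exists>\<phi>. bij_betw \<phi> (connections (awg_network m r)) (connections (shuffle_network m (r * m))) \<and>
      (\<forall>p<m. \<forall>a<r. \<forall>q'<m.
         \<phi> (awg_connection m p (a, q') ((p + q') mod m)) = shuffle_connection p (a * m + q')))"
proof (intro conjI allI impI)
  show "functionally_equivalent_to_shuffle m (r * m) (awg_network m r) (in_label m) (out_label m)"
    using assms(1) by (rule functionally_equivalent_awg_network)
  show "bij_betw (in_channel_at m) ({..<m} \<times> {..<r} \<times> {..<m}) (inputs (awg_network m r))"
    by (rule bij_betw_in_channel_at)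
  show "bij_betw (out_channel_at m) ({..<r} \<times> {..<m} \<times> {..<m}) (outputs (awg_network m r))"
    by (rule bij_betw_out_channel_at)
  show "\<exists>\<phi>. bij_betw \<phi> (connections (awg_network m r)) (connections (shuffle_network m (r * m))) \<and>
      (\<forall>p<m. \<forall>a<r. \<forall>q'<m.
         \<phi> (awg_connection m p (a, q') ((p + q') mod m)) = shuffle_connection p (a * m + q'))"
    \<comment> \<open>Unification with the bijection lemma supplies the witness
      \<open>\<phi>\<close>; its values on the named connections follow by evaluating the path's
      ports.\<close>
    by (rule exI, rule conjI, rule bij_betw_awg_shuffle_connections)
      (simp add: awg_connection_def)
  fix p a q' assume lt: "p < m" "a < r" "q' < m"
  show "out_port_label m (a * m + q') = (a, q')"
    using lt by (simp add: out_port_label_def)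
  show "{c \<in> connections (awg_network m r).
         in_group (awg_network m r) (source (awg_network m r) c) = p \<and>
         out_group (awg_network m r) (target (awg_network m r) c) = a * m + q'}
        = {awg_connection m p (a, q') ((p + q') mod m)}"
    using lt by (simp only: awg_connection_eq_awg_path connections_between_groups combine_less_mult)
  show "source (awg_network m r) (awg_connection m p (a, q') ((p + q') mod m))
        = in_channel_at m (p, a, q')"
    using lt by (simp add: awg_connection_eq_awg_path source_awg_path in_label_def)
  show "target (awg_network m r) (awg_connection m p (a, q') ((p + q') mod m))
        = out_channel_at m (a, q', p)"
    using lt by (simp add: awg_connection_eq_awg_path target_awg_path out_label_def)
qed

end
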